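(* Let $F(S)$ be the free group on a set $S$ with $|S| > 1$ and let $k \geq 1$ be an integer. Then for all nontrivial $w \in \gamma_k(F(S))$ we have $k \leq \|w\|_S$.
   Context: Lower central series of a group $G$: $\gamma_1(G)=G$ and $\gamma_{k+1}(G) = [\gamma_k(G),G]$. If $G$ is a group, $S \subset G$ and $x \in \langle S \rangle$, then $\|x\|_S$ denotes the length of the shortest word in $S \cup S^{-1}$ which equals $x$. *)

theory Defs
  imports "HOL-Algebra.Generated_Groups"
begin

section \<open>The free group on a set, as the group of reduced words\<close>

text \<open>The letter \<open>(s, True)\<close> stands for \<open>s\<close>, the letter \<open>(s, False)\<close> for its formal inverse.\<close>

type_synonym 'a letter = "'a \<times> bool"

definition inv_letter :: "'a letter \<Rightarrow> 'a letter" where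
  "inv_letter l = (fst l, \<not> snd l)"

fun reduced :: "'a letter list \<Rightarrow> bool" where
  "reduced [] \<longleftrightarrow> True"
| "reduced [l] \<longleftrightarrow> True"
| "reduced (l # m # ls) \<longleftrightarrow> m \<noteq> inv_letter l \<and> reduced (m # ls)"

text \<open>Left multiplication of a reduced word by a single letter, with cancellation.\<close>

fun cons_reduce :: "'a letter \<Rightarrow> 'a letter list \<Rightarrow> 'a letter list" where
  "cons_reduce l [] = [l]"
| "cons_reduce l (m # ls) = (if m = inv_letter l then ls else l # m # ls)"

definition free_group :: "'a set \<Rightarrow> 'a letter list monoid" where
  "free_group S =
    \<lparr> carrier = {u. reduced u \<and> fst ` set u \<subseteq> S},
      mult = (\<lambda>u v. foldr cons_reduce u v),
      one = [] \<rparr>"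

definition free_gen :: "'a \<Rightarrow> 'a letter list" where
  "free_gen s = [(s, True)]"


section \<open>Lower central series and word length\<close>

definition commutator_subgroup :: "('g, 'b) monoid_scheme \<Rightarrow> 'g set \<Rightarrow> 'g set \<Rightarrow> 'g set" where
  "commutator_subgroup G H K =
    generate G (\<Union>h \<in> H. \<Union>k \<in> K. { h \<otimes>\<^bsub>G\<^esub> k \<otimes>\<^bsub>G\<^esub> inv\<^bsub>G\<^esub> h \<otimes>\<^bsub>G\<^esub> inv\<^bsub>G\<^esub> k })"

text \<open>The series is indexed from \<open>1\<close>; the value at index \<open>0\<close> is a dummy.\<close>

fun lower_central :: "('g, 'b) monoid_scheme \<Rightarrow> nat \<Rightarrow> 'g set" where
  "lower_central G 0 = carrier G"
| "lower_central G (Suc 0) = carrier G"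
| "lower_central G (Suc (Suc k)) =
    commutator_subgroup G (lower_central G (Suc k)) (carrier G)"

text \<open>Only meaningful for \<open>x \<in> generate G S\<close>; otherwise no word qualifies and the \<open>LEAST\<close> is
  unspecified.\<close>

definition word_norm :: "('g, 'b) monoid_scheme \<Rightarrow> 'g set \<Rightarrow> 'g \<Rightarrow> nat" where
  "word_norm G S x =
    (LEAST n. \<exists>ws. length ws = n \<and> set ws \<subseteq> S \<union> m_inv G ` S \<and>
       foldr (\<lambda>a b. a \<otimes>\<^bsub>G\<^esub> b) ws \<one>\<^bsub>G\<^esub> = x)"


section \<open>\<open>free_group S\<close> is the free group on \<open>S\<close>\<close>

lemma free_group_simps:
  "carrier (free_group S) = {u. reduced u \<and> fst ` set u \<subseteq> S}"
  "mult (free_group S) u v = foldr cons_reduce u v"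
  "one (free_group S) = []"
  by (simp_all add: free_group_def)

lemma inv_letter_inv_letter [simp]: "inv_letter (inv_letter l) = l"
  by (simp add: inv_letter_def)

lemma fst_inv_letter [simp]: "fst (inv_letter l) = fst l"
  by (simp add: inv_letter_def)

lemma reduced_ConsD: "reduced (l # u) \<Longrightarrow> reduced u"
  by (cases u) auto

lemma cons_reduce_reduced [simp]: "reduced (l # u) \<Longrightarrow> cons_reduce l u = l # u"
  by (cases u) auto

lemma reduced_cons_reduce: "reduced u \<Longrightarrow> reduced (cons_reduce l u)"
  by (cases u) (auto dest: reduced_ConsD)

lemma set_cons_reduce: "set (cons_reduce l u) \<subseteq> insert l (set u)"
  by (cases u) auto

lemma cons_reduce_cancel:
  assumes "reduced u"
  shows "cons_reduce l (cons_reduce (inv_letter l) u) = u"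
proof (cases u)
  case (Cons m ls)
  show ?thesis
  proof (cases "m = l")
    case True
    then have "cons_reduce (inv_letter l) u = ls" using Cons by simp
    then show ?thesis using True Cons assms by (simp del: reduced.simps)
  qed (simp add: Cons)
qed simp

lemma reduced_foldr: "reduced v \<Longrightarrow> reduced (foldr cons_reduce u v)"
  by (induction u) (auto intro: reduced_cons_reduce)

lemma set_foldr_cons_reduce: "set (foldr cons_reduce u v) \<subseteq> set u \<union> set v"
proof (induction u)
  case (Cons l u)
  then show ?case using set_cons_reduce[of l "foldr cons_reduce u v"] by auto
qed simp

lemma foldr_cons_reduce_Nil: "reduced u \<Longrightarrow> foldr cons_reduce u [] = u"
proof (induction u)
  case (Cons l u)
  then show ?case using reduced_ConsD[OF Cons.prems] by simp
qed simp

lemma foldr_cons_reduce_cons_reduce: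
  assumes "reduced w"
  shows "foldr cons_reduce (cons_reduce l u) w = cons_reduce l (foldr cons_reduce u w)"
proof (cases u)
  case (Cons m ls)
  then show ?thesis
    using cons_reduce_cancel[OF reduced_foldr[OF assms], of l ls] by auto
qed simp

lemma foldr_cons_reduce_assoc:
  "reduced w \<Longrightarrow>
    foldr cons_reduce (foldr cons_reduce u v) w = foldr cons_reduce u (foldr cons_reduce v w)"
  by (induction u) (simp_all add: foldr_cons_reduce_cons_reduce)

lemma foldr_cons_reduce_inverse:
  "reduced w \<Longrightarrow> foldr cons_reduce (rev (map inv_letter u)) (foldr cons_reduce u w) = w"
proof (induction u arbitrary: w)
  case (Cons l u)
  have "cons_reduce (inv_letter l) (cons_reduce l v) = v" if "reduced v" for v
    using cons_reduce_cancel[OF that, of "inv_letter l"] by simp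
  then show ?case
    using Cons.IH[OF Cons.prems] reduced_foldr[OF Cons.prems, of u] by simp
qed simp

theorem group_free_group: "group (free_group S)"
proof (rule groupI)
  fix u v assume "u \<in> carrier (free_group S)" "v \<in> carrier (free_group S)"
  then have "reduced v" "fst ` set u \<subseteq> S" "fst ` set v \<subseteq> S"
    by (simp_all add: free_group_simps)
  moreover from this have "fst ` set (foldr cons_reduce u v) \<subseteq> S"
    using set_foldr_cons_reduce[of u v] by blast
  ultimately show "u \<otimes>\<^bsub>free_group S\<^esub> v \<in> carrier (free_group S)"
    by (simp add: free_group_simps reduced_foldr)
next
  fix u assume u: "u \<in> carrier (free_group S)"
  let ?v = "foldr cons_reduce (rev (map inv_letter u)) []"
  have "?v \<in> carrier (free_group S)"
    using u set_foldr_cons_reduce[of "rev (map inv_letter u)" "[]"]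
    by (fastforce simp: free_group_simps reduced_foldr)
  moreover have "foldr cons_reduce ?v u = []"
    using u foldr_cons_reduce_inverse[of "[]" u] foldr_cons_reduce_assoc[of u]
    by (simp add: free_group_simps foldr_cons_reduce_Nil)
  ultimately show "\<exists>v\<in>carrier (free_group S). v \<otimes>\<^bsub>free_group S\<^esub> u = \<one>\<^bsub>free_group S\<^esub>"
    by (auto simp: free_group_simps)
qed (auto simp: free_group_simps foldr_cons_reduce_assoc)

lemma free_gen_closed: "s \<in> S \<Longrightarrow> free_gen s \<in> carrier (free_group S)"
  by (simp add: free_gen_def free_group_simps)

lemma inv_free_gen: "s \<in> S \<Longrightarrow> inv\<^bsub>free_group S\<^esub> (free_gen s) = [(s, False)]"
  by (rule group.inv_equality[OF group_free_group])
    (auto simp: free_gen_def free_group_simps inv_letter_def)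

theorem generate_free_gen: "generate (free_group S) (free_gen ` S) = carrier (free_group S)"
proof
  show "generate (free_group S) (free_gen ` S) \<subseteq> carrier (free_group S)"
    by (intro group.generate_incl group_free_group) (auto intro: free_gen_closed)
next
  have "u \<in> generate (free_group S) (free_gen ` S)"
    if "reduced u" "fst ` set u \<subseteq> S" for u
    using that
  proof (induction u)
    case Nil
    then show ?case using generate.one[of "free_group S"] by (simp add: free_group_simps)
  next
    case (Cons l u)
    have u: "u \<in> generate (free_group S) (free_gen ` S)"
      using Cons.IH Cons.prems(2) reduced_ConsD[OF Cons.prems(1)] by simp
    have s: "fst l \<in> S" using Cons by auto
    have "[l] \<in> generate (free_group S) (free_gen ` S)"
    proof (cases "snd l")
      case True
      then have "[l] = free_gen (fst l)" by (simp add: free_gen_def prod_eq_iff)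
      then show ?thesis using s by (auto intro: generate.incl)
    next
      case False
      then have "[l] = inv\<^bsub>free_group S\<^esub> (free_gen (fst l))"
        using s by (simp add: inv_free_gen prod_eq_iff)
      then show ?thesis using s by (auto intro: generate.inv)
    qed
    from generate.eng[OF this u] show ?case using Cons.prems by (simp add: free_group_simps)
  qed
  then show "carrier (free_group S) \<subseteq> generate (free_group S) (free_gen ` S)"
    by (auto simp: free_group_simps)
qed

text \<open>Existence in the universal property; uniqueness is immediate from
  \<open>generate_free_gen\<close>.\<close>

theorem free_group_universal:
  assumes "group H" and f: "\<And>s. s \<in> S \<Longrightarrow> f s \<in> carrier H"
  shows "\<exists>h \<in> hom (free_group S) H. \<forall>s \<in> S. h (free_gen s) = f s"
proof -
  interpret H: group H by fact
  define L where "L l = (if snd l then f (fst l) else inv\<^bsub>H\<^esub> f (fst l))" for l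
  define h where "h u = foldr (\<lambda>l x. L l \<otimes>\<^bsub>H\<^esub> x) u \<one>\<^bsub>H\<^esub>" for u
  have Lc: "L l \<in> carrier H" if "fst l \<in> S" for l
    using that f by (simp add: L_def)
  have hc: "h u \<in> carrier H" if "fst ` set u \<subseteq> S" for u
    using that by (induction u) (auto simp: h_def Lc)
  have hcons: "h (cons_reduce l u) = L l \<otimes>\<^bsub>H\<^esub> h u"
    if "fst l \<in> S" "fst ` set u \<subseteq> S" for l u
  proof (cases u)
    case (Cons m ls)
    show ?thesis
    proof (cases "m = inv_letter l")
      case True
      have "L l \<otimes>\<^bsub>H\<^esub> L m = \<one>\<^bsub>H\<^esub>"
        using True that f by (simp add: L_def inv_letter_def)
      moreover have "h u = L m \<otimes>\<^bsub>H\<^esub> h ls" using Cons by (simp add: h_def)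
      moreover have "L m \<in> carrier H" "L l \<in> carrier H" "h ls \<in> carrier H"
        using that Cons by (auto intro: Lc hc)
      ultimately have "L l \<otimes>\<^bsub>H\<^esub> h u = h ls" by (simp flip: H.m_assoc)
      then show ?thesis using Cons True by simp
    qed (use Cons in \<open>simp add: h_def\<close>)
  qed (simp add: h_def)
  have "h (foldr cons_reduce u v) = h u \<otimes>\<^bsub>H\<^esub> h v"
    if "fst ` set u \<subseteq> S" "fst ` set v \<subseteq> S" for u v
    using that(1)
  proof (induction u)
    case Nil
    then show ?case using hc[OF that(2)] by (simp add: h_def)
  next
    case (Cons l u)
    then have c: "fst l \<in> S" "fst ` set u \<subseteq> S" by auto
    have "fst ` set (foldr cons_reduce u v) \<subseteq> S"
      using set_foldr_cons_reduce[of u v] c that(2) by blast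
    then have "h (foldr cons_reduce (l # u) v) = L l \<otimes>\<^bsub>H\<^esub> (h u \<otimes>\<^bsub>H\<^esub> h v)"
      using hcons c Cons.IH by simp
    also have "\<dots> = L l \<otimes>\<^bsub>H\<^esub> h u \<otimes>\<^bsub>H\<^esub> h v"
      using c that(2) by (simp add: H.m_assoc Lc hc)
    finally show ?case by (simp add: h_def)
  qed
  then have "h \<in> hom (free_group S) H"
    by (auto simp: hom_def free_group_simps hc)
  moreover have "\<forall>s \<in> S. h (free_gen s) = f s"
    using f by (simp add: h_def L_def free_gen_def)
  ultimately show ?thesis by blast
qed

end

(* Magnus expansion: sending the generator x to the non-commuting power series 1 + X makes the free
   group act on power series over the integers by left multiplication. An element of the k-th term
   of the lower central series changes a series of order j only in degrees at least j + k. On the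
   other hand, if the reduced word w is the product of powers x_1^e_1, ..., x_m^e_m of adjacent
   distinct generators, then the coefficient of the monomial X_1 ... X_m in its expansion is
   e_1 * ... * e_m, which is nonzero; and m is at most the length of w. Hence k <= m. *)

theory Submission
  imports Defs "HOL-Library.Sublist"
begin

section \<open>The Magnus action\<close>

text \<open>A power series in non-commuting variables is the function taking each monomial, a list of
  variables, to its coefficient. The letter \<open>(x, True)\<close> acts as multiplication by \<open>1 + X\<close>;
  the recursion for \<open>(x, False)\<close> solves \<open>(1 + X) * g = f\<close> for \<open>g\<close>.\<close>

fun magnus_letter :: "'a letter \<Rightarrow> ('a list \<Rightarrow> int) \<Rightarrow> 'a list \<Rightarrow> int" where
  "magnus_letter l f [] = f []"
| "magnus_letter l f (y # v) =
    f (y # v) + (if y = fst l then (if snd l then f v else - magnus_letter l f v) else 0)"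

definition magnus :: "'a letter list \<Rightarrow> ('a list \<Rightarrow> int) \<Rightarrow> 'a list \<Rightarrow> int" where
  "magnus u f = foldr magnus_letter u f"

definition vanishes_below :: "nat \<Rightarrow> ('a list \<Rightarrow> int) \<Rightarrow> bool" where
  "vanishes_below j f \<longleftrightarrow> (\<forall>v. length v < j \<longrightarrow> f v = 0)"

lemma vanishes_below_diff_trans:
  assumes "vanishes_below j (\<lambda>v. f v - g v)" "vanishes_below j (\<lambda>v. g v - h v)"
  shows "vanishes_below j (\<lambda>v. f v - h v)"
  using assms by (simp add: vanishes_below_def)

lemma magnus_Nil [simp]: "magnus [] f = f"
  by (simp add: magnus_def)

lemma magnus_Cons [simp]: "magnus (l # u) f = magnus_letter l (magnus u f)"
  by (simp add: magnus_def)

lemma magnus_letter_diff: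
  "magnus_letter l (\<lambda>v. f v - g v) v = magnus_letter l f v - magnus_letter l g v"
  by (induction v) auto

lemma magnus_diff: "magnus u (\<lambda>v. f v - g v) = (\<lambda>v. magnus u f v - magnus u g v)"
  by (induction u) (auto simp: magnus_letter_diff)

lemma magnus_letter_inv_letter: "magnus_letter l (magnus_letter (inv_letter l) f) = f"
proof
  show "magnus_letter l (magnus_letter (inv_letter l) f) v = f v" for v
    by (induction v) (auto simp: inv_letter_def)
qed

text \<open>Cancellation is invisible here, because a letter and its inverse act as mutually inverse
  operators; hence the group acts.\<close>

lemma magnus_cons_reduce: "magnus (cons_reduce l u) f = magnus_letter l (magnus u f)"
  by (cases u) (auto simp: magnus_letter_inv_letter)

lemma magnus_mult: "magnus (u \<otimes>\<^bsub>free_group S\<^esub> v) f = magnus u (magnus v f)"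
  by (induction u) (simp_all add: free_group_simps magnus_cons_reduce)

lemma magnus_inv:
  assumes "u \<in> carrier (free_group S)"
  shows "magnus (inv\<^bsub>free_group S\<^esub> u) (magnus u f) = f"
    and "magnus u (magnus (inv\<^bsub>free_group S\<^esub> u) f) = f"
proof -
  interpret group "free_group S" by (rule group_free_group)
  show "magnus (inv\<^bsub>free_group S\<^esub> u) (magnus u f) = f"
    using assms magnus_mult[of S "inv\<^bsub>free_group S\<^esub> u" u f]
    by (simp add: free_group_simps(3))
  show "magnus u (magnus (inv\<^bsub>free_group S\<^esub> u) f) = f"
    using assms magnus_mult[of S u "inv\<^bsub>free_group S\<^esub> u" f]
    by (simp add: free_group_simps(3))
qed

section \<open>The lower central series raises orders\<close>

text \<open>The dimension subgroups of the free group, as seen by the Magnus action.\<close>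

definition magnus_dimension :: "'a set \<Rightarrow> nat \<Rightarrow> 'a letter list set" where
  "magnus_dimension S k = {u \<in> carrier (free_group S).
    \<forall>j f. vanishes_below j f \<longrightarrow> vanishes_below (j + k) (\<lambda>v. magnus u f v - f v)}"

lemma magnus_dimension_carrier: "u \<in> magnus_dimension S k \<Longrightarrow> u \<in> carrier (free_group S)"
  by (simp add: magnus_dimension_def)

lemma magnus_dimensionD:
  "u \<in> magnus_dimension S k \<Longrightarrow> vanishes_below j f \<Longrightarrow>
    vanishes_below (j + k) (\<lambda>v. magnus u f v - f v)"
  by (simp add: magnus_dimension_def)

text \<open>The coefficient at a monomial is computed from suffixes of that monomial, so no lower
  degrees arise.\<close>

lemma vanishes_below_magnus_letter:
  assumes "vanishes_below j f"
  shows "vanishes_below j (magnus_letter l f)"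
proof -
  have "magnus_letter l f v = 0" if "length v < j" for v
    using that assms by (induction v) (auto simp: vanishes_below_def)
  then show ?thesis by (simp add: vanishes_below_def)
qed

lemma vanishes_below_magnus: "vanishes_below j f \<Longrightarrow> vanishes_below j (magnus u f)"
  by (induction u) (simp_all add: vanishes_below_magnus_letter)

lemma vanishes_below_magnus_letter_diff:
  assumes "vanishes_below j f"
  shows "vanishes_below (j + 1) (\<lambda>v. magnus_letter l f v - f v)"
proof -
  have "magnus_letter l f v - f v = 0" if "length v < j + 1" for v
    using that assms vanishes_below_magnus_letter[OF assms, of l]
    by (cases v) (auto simp: vanishes_below_def)
  then show ?thesis by (simp add: vanishes_below_def)
qed

lemma magnus_dimension_1: "magnus_dimension S 1 = carrier (free_group S)"
proof -
  have "vanishes_below (j + 1) (\<lambda>v. magnus u f v - f v)" if "vanishes_below j f"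
    for j u and f :: "'a list \<Rightarrow> int"
  proof (induction u)
    case Nil
    then show ?case by (simp add: vanishes_below_def)
  next
    case (Cons l u)
    from vanishes_below_diff_trans[OF
        vanishes_below_magnus_letter_diff[OF vanishes_below_magnus[OF that]] Cons]
    show ?case by simp
  qed
  then show ?thesis by (auto simp: magnus_dimension_def)
qed

text \<open>Follows from \<open>uv - 1 = (u - 1) v + (v - 1)\<close> and
  \<open>u^-1 - 1 = -(u - 1) u^-1\<close>, as the action preserves orders.\<close>

lemma subgroup_magnus_dimension: "subgroup (magnus_dimension S k) (free_group S)"
proof -
  interpret group "free_group S" by (rule group_free_group)
  show ?thesis
  proof (rule subgroupI)
    have "[] \<in> magnus_dimension S k"
      by (simp add: magnus_dimension_def vanishes_below_def free_group_simps)
    then show "magnus_dimension S k \<noteq> {}" by blast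
  next
    fix u assume u: "u \<in> magnus_dimension S k"
    have "vanishes_below (j + k) (\<lambda>v. magnus (inv\<^bsub>free_group S\<^esub> u) f v - f v)"
      if "vanishes_below j f" for j f
    proof -
      let ?g = "magnus (inv\<^bsub>free_group S\<^esub> u) f"
      have "vanishes_below (j + k) (\<lambda>v. magnus u ?g v - ?g v)"
        by (intro magnus_dimensionD[OF u] vanishes_below_magnus that)
      then show ?thesis
        using u by (simp add: magnus_inv magnus_dimension_carrier vanishes_below_def)
    qed
    then show "inv\<^bsub>free_group S\<^esub> u \<in> magnus_dimension S k"
      using u by (simp add: magnus_dimension_def)
  next
    fix u v assume u: "u \<in> magnus_dimension S k" and v: "v \<in> magnus_dimension S k"
    have "vanishes_below (j + k) (\<lambda>x. magnus (u \<otimes>\<^bsub>free_group S\<^esub> v) f x - f x)"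
      if "vanishes_below j f" for j f
      using vanishes_below_diff_trans[OF magnus_dimensionD[OF u vanishes_below_magnus[OF that]]
          magnus_dimensionD[OF v that]]
      by (simp add: magnus_mult)
    then show "u \<otimes>\<^bsub>free_group S\<^esub> v \<in> magnus_dimension S k"
      using u v by (simp add: magnus_dimension_def)
  qed (auto simp: magnus_dimension_def)
qed

lemma commutator_magnus_dimension:
  assumes h: "h \<in> magnus_dimension S k" and g: "g \<in> magnus_dimension S m"
  shows "h \<otimes>\<^bsub>free_group S\<^esub> g \<otimes>\<^bsub>free_group S\<^esub> inv\<^bsub>free_group S\<^esub> h \<otimes>\<^bsub>free_group S\<^esub> inv\<^bsub>free_group S\<^esub> g
    \<in> magnus_dimension S (k + m)" (is "?c \<in> _")
proof -
  interpret group "free_group S" by (rule group_free_group)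
  have hc: "h \<in> carrier (free_group S)" and gc: "g \<in> carrier (free_group S)"
    using h g by (simp_all add: magnus_dimension_carrier)
  have "vanishes_below (j + (k + m)) (\<lambda>v. magnus ?c f v - f v)" if "vanishes_below j f" for j f
  proof -
    \<comment> \<open>This choice absorbs both inverses: \<open>f\<close> equals \<open>gha\<close>
      and \<open>?c\<close> sends it to \<open>hga\<close>, so only \<open>hg - gh\<close> applied
      to \<open>a\<close> has to be estimated.\<close>
    define a where "a = magnus (inv\<^bsub>free_group S\<^esub> h) (magnus (inv\<^bsub>free_group S\<^esub> g) f)"
    have a: "vanishes_below j a"
      unfolding a_def by (intro vanishes_below_magnus that)
    have f: "f = magnus g (magnus h a)"
      using hc gc by (simp add: a_def magnus_inv)
    have c: "magnus ?c f = magnus h (magnus g a)"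
      by (simp add: magnus_mult a_def)
    have 1: "vanishes_below (j + m + k)
        (\<lambda>v. magnus h (\<lambda>v. magnus g a v - a v) v - (magnus g a v - a v))"
      using magnus_dimensionD[OF h magnus_dimensionD[OF g a]] .
    have 2: "vanishes_below (j + k + m)
        (\<lambda>v. magnus g (\<lambda>v. magnus h a v - a v) v - (magnus h a v - a v))"
      using magnus_dimensionD[OF g magnus_dimensionD[OF h a]] .
    \<comment> \<open>\<open>hg - gh = (h - 1) (g - 1) - (g - 1) (h - 1)\<close>\<close>
    have "magnus h (magnus g a) v - magnus g (magnus h a) v = 0" if "length v < j + (k + m)" for v
    proof -
      have "magnus h (magnus g a) v - magnus h a v - (magnus g a v - a v) = 0"
        using 1 that by (simp add: vanishes_below_def magnus_diff)
      moreover have "magnus g (magnus h a) v - magnus g a v - (magnus h a v - a v) = 0"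
        using 2 that by (simp add: vanishes_below_def magnus_diff)
      ultimately show ?thesis by linarith
    qed
    then show ?thesis
      unfolding c by (subst f) (simp add: vanishes_below_def)
  qed
  then show ?thesis using hc gc by (simp add: magnus_dimension_def)
qed

lemma lower_central_subset_magnus_dimension:
  "lower_central (free_group S) (Suc k) \<subseteq> magnus_dimension S (Suc k)"
proof (induction k)
  case 0
  then show ?case by (simp add: magnus_dimension_1[unfolded One_nat_def])
next
  case (Suc k)
  interpret group "free_group S" by (rule group_free_group)
  have "h \<otimes>\<^bsub>free_group S\<^esub> g \<otimes>\<^bsub>free_group S\<^esub> inv\<^bsub>free_group S\<^esub> h \<otimes>\<^bsub>free_group S\<^esub> inv\<^bsub>free_group S\<^esub> g
      \<in> magnus_dimension S (Suc (Suc k))"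
    if "h \<in> lower_central (free_group S) (Suc k)" "g \<in> carrier (free_group S)" for h g
    \<comment> \<open>Every \<open>g\<close> lies in level 1, which accounts for the increment by
      one.\<close>
    using commutator_magnus_dimension[of h S "Suc k" g 1] that Suc
    unfolding magnus_dimension_1 by auto
  then show ?case
    unfolding lower_central.simps commutator_subgroup_def
    by (intro generate_subgroup_incl subgroup_magnus_dimension) blast
qed

section \<open>A nonzero coefficient\<close>

text \<open>In \<open>1 - X + X^2 - ...\<close>, the inverse of \<open>1 + X\<close>, only the first
  two terms can meet a monomial without adjacent repetitions.\<close>

lemma magnus_letter_distinct_adj:
  assumes "distinct_adj (y # v)"
  shows "magnus_letter l f (y # v) =
    f (y # v) + (if y = fst l then (if snd l then f v else - f v) else 0)"
  using assms by (cases v) auto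

text \<open>The classical Magnus expansion of \<open>u\<close>, obtained by acting on the constant
  series 1.\<close>

abbreviation magnus_one :: "'a letter list \<Rightarrow> 'a list \<Rightarrow> int" where
  "magnus_one u \<equiv> magnus u (\<lambda>v. if v = [] then 1 else 0)"

text \<open>Towards such a monomial each letter of the word contributes at most one variable, its
  own, and in order.\<close>

lemma magnus_one_eq_0:
  assumes "distinct_adj v" "\<not> subseq v (map fst u)"
  shows "magnus_one u v = 0"
  using assms
proof (induction u arbitrary: v)
  case (Cons l u)
  from Cons.prems obtain y v' where v: "v = y # v'" by (cases v) auto
  have "\<not> subseq v (map fst u)"
    using Cons.prems(2) by auto
  moreover have "\<not> subseq v' (map fst u)" if "y = fst l"
    using Cons.prems(2) that v by auto
  moreover have "distinct_adj v'"
    using Cons.prems(1) v by (cases v') auto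
  ultimately show ?case
    using Cons.prems(1) Cons.IH unfolding v
    by (auto simp: magnus_letter_distinct_adj simp del: magnus_letter.simps(2))
qed (auto split: if_splits)

text \<open>Such a subsequence takes at most one element from each run of equal elements, and
  \<open>remdups_adj\<close> keeps one per run.\<close>

lemma length_subseq_distinct_adj:
  "subseq v u \<Longrightarrow> distinct_adj v \<Longrightarrow> length v \<le> length (remdups_adj u)"
proof (induction u arbitrary: v rule: remdups_adj.induct)
  case (2 x)
  then have "length v \<le> length [x]" using list_emb_length by blast
  then show ?case by simp
next
  case (3 x y u)
  show ?case
  proof (cases "subseq v (y # u)")
    case True
    then show ?thesis using 3 by (cases "x = y") (auto intro: le_SucI)
  next
    case False
    then obtain v' where v: "v = x # v'" "subseq v' (y # u)"
      using "3.prems"(1) by (cases v) (auto split: if_splits)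
    have adj: "distinct_adj v'" using v "3.prems"(2) by (cases v') auto
    show ?thesis
    proof (cases "x = y")
      case True
      \<comment> \<open>\<open>v'\<close> cannot start with \<open>y\<close>, so it embeds in
        \<open>u\<close>; then \<open>v\<close> embeds in \<open>y # u\<close>, which this case
        excludes.\<close>
      then have "subseq v' u"
        using v "3.prems"(2) by (cases v') (auto split: if_splits)
      then show ?thesis using v True False by auto
    next
      case False
      then show ?thesis using "3.IH"(2)[OF _ v(2) adj] v by simp
    qed
  qed
qed simp

text \<open>Here \<open>e\<close> is the absolute value of the exponent of the first syllable \<open>x\<close> of the word.\<close>

lemma magnus_one_remdups_adj_aux:
  assumes "reduced ((x, b) # u)"
  shows "\<exists>e>0. magnus_one ((x, b) # u) (remdups_adj (x # map fst u)) =
      (if b then e else - e) * magnus_one ((x, b) # u) (tl (remdups_adj (x # map fst u))) \<and>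
    magnus_one ((x, b) # u) (tl (remdups_adj (x # map fst u))) \<noteq> 0"
  using assms
proof (induction u arbitrary: x b)
  case Nil
  then show ?case by (auto intro!: exI[of _ 1])
next
  case (Cons l u)
  obtain y c where l: "l = (y, c)" by (cases l)
  define c1 where "c1 = magnus_one ((y, c) # u)"
  define r where "r = remdups_adj (y # map fst u)"
  have r: "r = y # tl r"
    by (simp add: r_def remdups_adj_Cons split: list.splits)
  have adj: "distinct_adj r" by (simp add: r_def)
  have "reduced ((y, c) # u)" using Cons.prems l by simp
  from Cons.IH[OF this] obtain e where e: "e > 0"
    "c1 r = (if c then e else - e) * c1 (tl r)" "c1 (tl r) \<noteq> 0"
    unfolding c1_def r_def by blast
  have c: "magnus_one ((x, b) # l # u) = magnus_letter (x, b) c1"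
    by (simp add: c1_def l)
  show ?case
  proof (cases "x = y")
    case True
    \<comment> \<open>The letter lengthens the first syllable. Reducedness rules out the opposite
      sign, so \<open>e\<close> grows by one.\<close>
    then have b: "b = c"
      using Cons.prems l by (auto simp: inv_letter_def)
    have t: "remdups_adj (x # map fst (l # u)) = r" using l True by (simp add: r_def)
    have 1: "magnus_letter (x, b) c1 r = c1 r + (if b then c1 (tl r) else - c1 (tl r))"
      using magnus_letter_distinct_adj[of y "tl r" "(x, b)" c1] adj r True by simp
    \<comment> \<open>\<open>tl r\<close> is empty or starts with a generator other than
      \<open>x\<close>.\<close>
    have 2: "magnus_letter (x, b) c1 (tl r) = c1 (tl r)"
    proof (cases "tl r")
      case (Cons z r')
      then have "r = y # z # r'" using r by simp
      then show ?thesis using adj True Cons by auto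
    qed simp
    show ?thesis
      unfolding c t 1 2 using e b by (intro exI[of _ "e + 1"]) (auto simp: algebra_simps)
  next
    case False
    have t: "remdups_adj (x # map fst (l # u)) = x # r" using l False by (simp add: r_def)
    have adj': "distinct_adj (x # r)" using adj False by (metis distinct_adj_Cons_Cons r)
    \<comment> \<open>\<open>r\<close> has one entry per syllable of the remaining word, so the
      longer \<open>x # r\<close> has coefficient zero there.\<close>
    have "length (x # r) > length (remdups_adj (map fst ((y, c) # u)))"
      by (simp add: r_def)
    then have "\<not> subseq (x # r) (map fst ((y, c) # u))"
      using length_subseq_distinct_adj[OF _ adj'] by fastforce
    then have 0: "c1 (x # r) = 0"
      unfolding c1_def by (rule magnus_one_eq_0[OF adj'])
    have 1: "magnus_letter (x, b) c1 (x # r) = (if b then c1 r else - c1 r)"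
      using magnus_letter_distinct_adj[OF adj', of "(x, b)" c1] 0 by simp
    have 2: "magnus_letter (x, b) c1 r = c1 r"
      using False by (subst (1 2) r) simp
    \<comment> \<open>The new syllable has exponent 1 or -1, and \<open>c1 r\<close> is nonzero by
      the induction hypothesis.\<close>
    show ?thesis
      unfolding c t list.sel 1 2 using e by (intro exI[of _ 1]) auto
  qed
qed

lemma magnus_one_remdups_adj:
  assumes "reduced u"
  shows "magnus_one u (remdups_adj (map fst u)) \<noteq> 0"
proof (cases u)
  case (Cons l u')
  then show ?thesis
    using magnus_one_remdups_adj_aux[of "fst l" "snd l" u'] assms by (auto split: if_splits)
qed simp

lemma lower_central_free_group_length:
  assumes "w \<in> lower_central (free_group S) k" "k \<ge> 1" "w \<noteq> []"
  shows "k \<le> length w"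
proof (rule ccontr)
  assume "\<not> k \<le> length w"
  obtain k' where k: "k = Suc k'" using assms(2) by (cases k) auto
  have w: "w \<in> magnus_dimension S k"
    using assms(1) lower_central_subset_magnus_dimension unfolding k by blast
  \<comment> \<open>The series 1 has order at least 0, so \<open>w\<close> changes it only in
    degrees \<open>k\<close> and above.\<close>
  have "vanishes_below 0 (\<lambda>v::'a list. if v = [] then 1 else 0)"
    by (simp add: vanishes_below_def)
  from magnus_dimensionD[OF w this]
  have *: "magnus_one w v = (if v = [] then 1 else 0)" if "length v < k" for v
    using that by (simp add: vanishes_below_def)
  have "length (remdups_adj (map fst w)) \<le> length w"
    using remdups_adj_length[of "map fst w"] by simp
  then have "length (remdups_adj (map fst w)) < k"
    using \<open>\<not> k \<le> length w\<close> by simp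
  \<comment> \<open>As \<open>w\<close> is nonempty, so is the monomial, and the series 1 has
    coefficient 0 there.\<close>
  from *[OF this] have "magnus_one w (remdups_adj (map fst w)) = 0"
    using assms(3) by simp
  moreover have "reduced w"
    using magnus_dimension_carrier[OF w] by (simp add: free_group_simps)
  ultimately show False using magnus_one_remdups_adj by blast
qed

section \<open>Word length\<close>

lemma length_cons_reduce: "length (cons_reduce l u) \<le> Suc (length u)"
  by (cases u) auto

lemma free_group_generators:
  fixes S :: "'a set"
  shows "free_gen ` S \<union> m_inv (free_group S) ` free_gen ` S = {[l] |l. fst l \<in> S}"
proof (intro equalityI subsetI)
  fix u assume "u \<in> free_gen ` S \<union> m_inv (free_group S) ` free_gen ` S"
  then show "u \<in> {[l] |l. fst l \<in> S}"
    by (auto simp: inv_free_gen) (auto simp: free_gen_def)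
next
  fix u :: "'a letter list"
  assume "u \<in> {[l] |l. fst l \<in> S}"
  then obtain s b where u: "u = [(s, b)]" "s \<in> S" by auto
  show "u \<in> free_gen ` S \<union> m_inv (free_group S) ` free_gen ` S"
  proof (cases b)
    case True
    then have "u = free_gen s" using u by (simp add: free_gen_def)
    then show ?thesis using u(2) by blast
  next
    case False
    then have "u = m_inv (free_group S) (free_gen s)" using u by (simp add: inv_free_gen)
    then show ?thesis using u(2) by blast
  qed
qed

lemma length_le_word_norm:
  assumes "w \<in> carrier (free_group S)"
  shows "length w \<le> word_norm (free_group S) (free_gen ` S) w"
proof -
  let ?P = "\<lambda>n. \<exists>ws. length ws = n \<and>
    set ws \<subseteq> free_gen ` S \<union> m_inv (free_group S) ` free_gen ` S \<and>
    foldr (\<lambda>a b. a \<otimes>\<^bsub>free_group S\<^esub> b) ws \<one>\<^bsub>free_group S\<^esub> = w"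
  \<comment> \<open>The letters of \<open>w\<close> spell \<open>w\<close>, so the minimum in
    \<open>word_norm\<close> is attained.\<close>
  have "foldr (\<lambda>a b. a \<otimes>\<^bsub>free_group S\<^esub> b) (map (\<lambda>l. [l]) w) \<one>\<^bsub>free_group S\<^esub> = w"
    using assms foldr_cons_reduce_Nil[of w] by (simp add: free_group_simps foldr_map o_def)
  moreover have "set (map (\<lambda>l. [l]) w) \<subseteq> {[l] |l. fst l \<in> S}"
    using assms by (auto simp: free_group_simps)
  ultimately have "?P (length w)"
    unfolding free_group_generators by (intro exI[of _ "map (\<lambda>l. [l]) w"]) auto
  then have "?P (LEAST n. ?P n)" by (rule LeastI)
  then obtain ws where ws: "length ws = word_norm (free_group S) (free_gen ` S) w"
    "set ws \<subseteq> {[l] |l. fst l \<in> S}"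
    "foldr (\<lambda>a b. a \<otimes>\<^bsub>free_group S\<^esub> b) ws \<one>\<^bsub>free_group S\<^esub> = w"
    unfolding word_norm_def free_group_generators by blast
  \<comment> \<open>Multiplying by one generator or its inverse lengthens a reduced word by at most
    one.\<close>
  have "length (foldr (\<lambda>a b. a \<otimes>\<^bsub>free_group S\<^esub> b) ws \<one>\<^bsub>free_group S\<^esub>) \<le> length ws"
    using ws(2)
  proof (induction ws)
    case (Cons a ws)
    then obtain l where "a = [l]" by auto
    then show ?case
      using Cons length_cons_reduce[of l "foldr (mult (free_group S)) ws \<one>\<^bsub>free_group S\<^esub>"]
      by (simp add: free_group_simps(2)[of S "[l]"])
  qed (simp add: free_group_simps)
  then show ?thesis using ws by simp
qed

theorem theorem1p2:
  fixes S :: "'a set" and k :: nat and w :: "'a letter list"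
  assumes "infinite S \<or> card S > 1"
    and "k \<ge> 1"
    and "w \<in> lower_central (free_group S) k"
    and "w \<noteq> \<one>\<^bsub>free_group S\<^esub>"
  shows "k \<le> word_norm (free_group S) (free_gen ` S) w"
proof -
  obtain k' where k: "k = Suc k'" using assms(2) by (cases k) auto
  have "w \<in> carrier (free_group S)"
    using assms(3) lower_central_subset_magnus_dimension magnus_dimension_carrier
    unfolding k by blast
  then have "length w \<le> word_norm (free_group S) (free_gen ` S) w"
    by (rule length_le_word_norm)
  moreover have "k \<le> length w"
    using assms(2-4) by (intro lower_central_free_group_length) (simp_all add: free_group_simps)
  ultimately show ?thesis by simp
qed

end
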